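(* Let $F$ and $F^{-1}$ be the transforms defined in the context by $$F[\phi](\lambda)=\int_0^\infty e^{-i\lambda y}\phi(y)\,dy\ (\lambda\in\mathbb R),\qquad F[\phi](\lambda)=\int_0^\infty \phi(y)\left[\alpha^2 e^{-i\alpha\lambda y}+\alpha e^{-i\alpha^2\lambda y}\right]dy\ (\lambda\in\partial D^+),$$ $$F^{-1}[f](x)=\frac1{2\pi}\int_{\mathbb R\cup\partial D^+}e^{i\lambda x}f(\lambda)\,d\lambda .$$ Then $F$ and $F^{-1}$ are both linear and, for all $\phi\in\mathcal S[0,\infty)$ and all $x\in(0,\infty)$, $F^{-1}[F[\phi]](x)=\phi(x)$.
   Context: $\mathcal S[0,\infty)$ is the space of (complex valued) smooth functions on $[0,\infty)$ (smooth up to $0$) which decay rapidly at infinity along with all of their derivatives. Let $\alpha=e^{2\pi i/3}$. $D^+=\{\lambda\in\mathbb C\setminus\{0\}:\arg\lambda\in(\pi/3,2\pi/3)\}$, and $\partial D^+$ is its boundary contour, positively oriented ($D^+$ lies to the left): it comes from $\infty$ along the ray $\arg\lambda=2\pi/3$ to $0$ and goes out to $\infty$ along the ray $\arg\lambda=\pi/3$. The contour $\mathbb R$ is oriented in the increasing sense. For $\phi\in\mathcal S[0,\infty)$, the transform $F[\phi]$ is the function on $\mathbb R\cup\partial D^+$ with one formula on each contour: $$F[\phi](\lambda)=\begin{cases}\int_0^\infty e^{-i\lambda y}\phi(y)\,dy & \lambda\in\mathbb R,\\[2pt] \int_0^\infty \phi(y)\left[\alpha^2 e^{-i\alpha\lambda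 y}+\alpha e^{-i\alpha^2\lambda y}\right]dy & \lambda\in\partial D^+.\end{cases}$$ (The two contours meet only at $0$; a function on $\mathbb R\cup\partial D^+$ means a pair consisting of a function on $\mathbb R$ and a function on $\partial D^+$.) The inverse transform is $$F^{-1}[f](x)=\frac1{2\pi}\int_{\mathbb R\cup\partial D^+}e^{i\lambda x}f(\lambda)\,d\lambda=\frac1{2\pi}\int_{\mathbb R}e^{i\lambda x}f(\lambda)\,d\lambda+\frac1{2\pi}\int_{\partial D^+}e^{i\lambda x}f(\lambda)\,d\lambda,$$ where each integral over an unbounded contour is improper, understood as the limit as $N\to\infty$ of the integral over the part of the contour with $|\lambda|\leq N$. Linearity of $F^{-1}$ is meant on functions $f$ for which these limits exist. *)

theory Defs
  imports "HOL-Complex_Analysis.Complex_Analysis"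
begin

text \<open>
  Functions on \<open>[0,\<infinity>)\<close> are total functions on the reals whose values at negative arguments are
  irrelevant: all derivatives are taken within \<open>{0..}\<close> (hence one-sided at \<open>0\<close>) and all integrals
  and conditions range over \<open>{0..}\<close>.
\<close>

primrec halfline_deriv :: "nat \<Rightarrow> (real \<Rightarrow> complex) \<Rightarrow> real \<Rightarrow> complex" where
  "halfline_deriv 0 \<phi> = \<phi>"
| "halfline_deriv (Suc n) \<phi> = (\<lambda>x. vector_derivative (halfline_deriv n \<phi>) (at x within {0..}))"

definition schwartz_halfline :: "(real \<Rightarrow> complex) set" where
  "schwartz_halfline = {\<phi>.
     (\<forall>n. \<forall>x\<ge>0. halfline_deriv n \<phi> differentiable (at x within {0..})) \<and>
     (\<forall>n k. bounded ((\<lambda>x. of_real (x ^ k) * halfline_deriv n \<phi> x) ` {0..}))}"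

definition alpha :: complex where
  "alpha = exp (2 * of_real pi * \<i> / 3)"

definition D_plus :: "complex set" where
  "D_plus = {l. l \<noteq> 0 \<and> pi / 3 < Arg l \<and> Arg l < 2 * pi / 3}"

text \<open>
  A function on \<open>\<real> \<union> \<partial>D\<^sup>+\<close> is a pair: the first component matters only on \<open>\<real>\<close>, the second only on
  \<open>frontier D_plus\<close>. Off these sets the components have no meaning (the defining integrals below
  need not exist there).
\<close>

type_synonym contour_fun = "(complex \<Rightarrow> complex) \<times> (complex \<Rightarrow> complex)"

definition transform :: "(real \<Rightarrow> complex) \<Rightarrow> contour_fun" where
  "transform \<phi> =
     ((\<lambda>l. LINT y:{0..}|lborel. exp (- \<i> * l * of_real y) * \<phi> y),
      (\<lambda>l. LINT y:{0..}|lborel. \<phi> y *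
             (alpha\<^sup>2 * exp (- \<i> * alpha * l * of_real y) + alpha * exp (- \<i> * alpha\<^sup>2 * l * of_real y))))"

definition contour_real :: "real \<Rightarrow> real \<Rightarrow> complex" where
  "contour_real N = linepath (- of_real N) (of_real N)"

definition contour_D_plus :: "real \<Rightarrow> real \<Rightarrow> complex" where
  "contour_D_plus N =
     linepath (of_real N * exp (2 * of_real pi * \<i> / 3)) 0 +++
     linepath 0 (of_real N * exp (of_real pi * \<i> / 3))"

definition improper_contour_integral ::
    "(real \<Rightarrow> real \<Rightarrow> complex) \<Rightarrow> (complex \<Rightarrow> complex) \<Rightarrow> complex" where
  "improper_contour_integral \<gamma> g = Lim at_top (\<lambda>N. contour_integral (\<gamma> N) g)"

definition improper_contour_integrable ::
    "(real \<Rightarrow> real \<Rightarrow> complex) \<Rightarrow> (complex \<Rightarrow> complex) \<Rightarrow> bool" where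
  "improper_contour_integrable \<gamma> g \<longleftrightarrow>
     (\<forall>N>0. g contour_integrable_on \<gamma> N) \<and>
     (\<exists>L. ((\<lambda>N. contour_integral (\<gamma> N) g) \<longlongrightarrow> L) at_top)"

definition inverse_transform :: "contour_fun \<Rightarrow> real \<Rightarrow> complex" where
  "inverse_transform f x =
     1 / (2 * of_real pi) * improper_contour_integral contour_real
       (\<lambda>l. exp (\<i> * l * of_real x) * fst f l) +
     1 / (2 * of_real pi) * improper_contour_integral contour_D_plus
       (\<lambda>l. exp (\<i> * l * of_real x) * snd f l)"

definition inverse_transform_exists :: "contour_fun \<Rightarrow> real \<Rightarrow> bool" where
  "inverse_transform_exists f x \<longleftrightarrow>
     improper_contour_integrable contour_real (\<lambda>l. exp (\<i> * l * of_real x) * fst f l) \<and>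
     improper_contour_integrable contour_D_plus (\<lambda>l. exp (\<i> * l * of_real x) * snd f l)"

definition contour_fun_lincomb ::
    "complex \<Rightarrow> contour_fun \<Rightarrow> complex \<Rightarrow> contour_fun \<Rightarrow> contour_fun" where
  "contour_fun_lincomb a f b g =
     ((\<lambda>l. a * fst f l + b * fst g l), (\<lambda>l. a * snd f l + b * snd g l))"

definition contour_fun_eq :: "contour_fun \<Rightarrow> contour_fun \<Rightarrow> bool" where
  "contour_fun_eq f g \<longleftrightarrow>
     (\<forall>l\<in>\<real>. fst f l = fst g l) \<and> (\<forall>l\<in>frontier D_plus. snd f l = snd g l)"

end

theory Submission
  imports Defs "HOL-Probability.Sinc_Integral"
begin

text \<open>
  Linearity only needs convergence. The delicate point is the second formula of the transform: both
  \<open>\<bar>exp (- \<i> \<alpha> l y)\<bar>\<close> and \<open>\<bar>exp (- \<i> \<alpha>\<^sup>2 l y)\<bar>\<close> are at most \<open>1\<close> as soon as \<open>Im (\<alpha> l) \<le> 0\<close> and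
  \<open>Im (\<alpha>\<^sup>2 l) \<le> 0\<close>, and these two closed conditions hold on the sector, hence on its boundary
  (\<open>frontier_D_plus_subset\<close>).

  For the inversion, Fubini's theorem on the truncated contours moves the integral over \<open>l\<close> inside
  the integral over \<open>y\<close> (\<open>has_contour_integral_linepath_Fubini\<close>). Then the two contours contribute
  \<open>2 \<pi> \<phi> x\<close> and \<open>0\<close>.

  On the real line the inner integral is the Dirichlet kernel \<open>2 sin (N (y - x)) / (y - x)\<close>, the
  \<open>y\<close>-derivative of \<open>2 Si (N (y - x))\<close>. As \<open>\<phi>\<close> is differentiable with integrable derivative, the kernel
  can be integrated by parts onto the sine integral \<open>Si\<close>, which is bounded and tends to
  \<open>\<plusminus> \<pi> / 2\<close>; dominated convergence gives the limit without the Riemann-Lebesgue lemma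
  (\<open>Dirichlet_kernel_limit\<close>).

  On the boundary of the sector the integrand is, for fixed \<open>y\<close>, a sum of two terms
  \<open>\<gamma> exp (\<i> l (x - \<beta> y))\<close> with \<open>{\<beta>, \<gamma>} = {\<alpha>, \<alpha>\<^sup>2}\<close>. Each has an explicit primitive, so only the two
  endpoints of the truncated contour count. They have imaginary part \<open>\<surd>3 N / 2\<close>, where
  \<open>exp (\<i> l x)\<close> is exponentially small because \<open>x > 0\<close>, and the divisor satisfies
  \<open>\<bar>x - \<beta> y\<bar> \<ge> x\<close> because \<open>Re \<beta> < 0\<close>. The bound is uniform in \<open>y\<close>, so the whole contribution
  vanishes in the limit (\<open>norm_contour_integral_sector_kernel_le\<close>). Working with primitives before
  integrating over \<open>y\<close> replaces the usual argument that closes the contour by a large arc.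
\<close>

section \<open>Calculus on a half-line\<close>

lemma set_integral_halfline_derivative:
  fixes H h :: "real \<Rightarrow> complex"
  assumes der: "\<And>y. y \<ge> a \<Longrightarrow> (H has_vector_derivative h y) (at y within {a..})"
    and int: "set_integrable lborel {a..} h"
    and lim: "(H \<longlongrightarrow> 0) at_top"
  shows "(LINT y:{a..}|lborel. h y) = - H a"
proof -
  have "((\<lambda>b. LINT y:{a..b}|lborel. h y) \<longlongrightarrow> (LINT y:{a..}|lborel. h y)) at_top"
    by (rule tendsto_set_lebesgue_integral_at_top[OF _ int]) auto
  moreover have "\<forall>\<^sub>F b in at_top. (LINT y:{a..b}|lborel. h y) = H b - H a"
    using eventually_ge_at_top[of a]
  proof eventually_elim
    case (elim b)
    have "(h has_integral (H b - H a)) {a..b}"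
      using elim by (intro fundamental_theorem_of_calculus)
        (auto intro!: has_vector_derivative_within_subset[OF der])
    moreover have "set_integrable lborel {a..b} h"
      by (rule set_integrable_subset[OF int]) auto
    ultimately show ?case
      by (simp add: set_borel_integral_eq_integral(2) integral_unique)
  qed
  ultimately have "((\<lambda>b. H b - H a) \<longlongrightarrow> (LINT y:{a..}|lborel. h y)) at_top"
    by (simp cong: tendsto_cong)
  moreover have "((\<lambda>b. H b - H a) \<longlongrightarrow> 0 - H a) at_top"
    by (intro tendsto_intros lim)
  ultimately show ?thesis
    using tendsto_unique[OF trivial_limit_at_top_linorder] by fastforce
qed

lemma set_integrable_mult_bounded:
  fixes f g :: "real \<Rightarrow> complex"
  assumes "set_integrable lborel A f" and [measurable]: "g \<in> borel_measurable borel"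
    and bd: "\<And>y. y \<in> A \<Longrightarrow> norm (g y) \<le> B" 
  shows "set_integrable lborel A (\<lambda>y. f y * g y)"
  unfolding set_integrable_def
proof (rule Bochner_Integration.integrable_bound)
  let ?f = "\<lambda>y. indicat_real A y *\<^sub>R f y"
  have f: "integrable lborel ?f"
    using assms(1) by (simp add: set_integrable_def)
  then show "integrable lborel (\<lambda>y. B * norm (?f y))"
    by (intro integrable_mult_right integrable_norm)
  have [measurable]: "?f \<in> borel_measurable borel"
    using borel_measurable_integrable[OF f] by simp
  have "(\<lambda>y. ?f y * g y) \<in> borel_measurable lborel" by measurable
  then show "(\<lambda>y. indicat_real A y *\<^sub>R (f y * g y)) \<in> borel_measurable lborel"
    by simp
  show "AE y in lborel. norm (indicat_real A y *\<^sub>R (f y * g y)) \<le> norm (B * norm (?f y))"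
  proof (rule AE_I2)
    fix y
    have "norm (f y) * norm (g y) \<le> \<bar>B\<bar> * norm (f y)" if "y \<in> A"
      using mult_left_mono[OF bd[OF that], of "norm (f y)"] mult_right_mono[OF abs_ge_self[of B], of "norm (f y)"]
      by (simp add: mult.commute)
    then show "norm (indicat_real A y *\<^sub>R (f y * g y)) \<le> norm (B * norm (?f y))"
      by (auto simp: indicator_def norm_mult)
  qed
qed

section \<open>Schwartz functions on the half-line\<close>

lemma schwartz_halfline_has_derivative:
  assumes "\<phi> \<in> schwartz_halfline" "y \<ge> 0"
  shows "(halfline_deriv n \<phi> has_vector_derivative halfline_deriv (Suc n) \<phi> y) (at y within {0..})"
  using assms by (simp add: schwartz_halfline_def vector_derivative_works)

lemma schwartz_halfline_bound:
  assumes "\<phi> \<in> schwartz_halfline"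
  obtains B where "\<And>y. y \<ge> 0 \<Longrightarrow> y ^ k * norm (halfline_deriv n \<phi> y) \<le> B"
proof -
  have "bounded ((\<lambda>x. of_real (x ^ k) * halfline_deriv n \<phi> x) ` {0..})"
    using assms unfolding schwartz_halfline_def by blast
  then obtain B where "\<forall>y\<ge>0. norm (of_real (y ^ k) * halfline_deriv n \<phi> y) \<le> B"
    unfolding bounded_iff by auto
  then show thesis
    by (intro that[of B]) (auto simp: norm_mult norm_power)
qed

lemma set_integrable_inverse_1_plus_square:
  "set_integrable lborel {0..} (\<lambda>x::real. 1 / (1 + x\<^sup>2))"
proof -
  have "integrable lborel (\<lambda>x::real. indicator {0<..} x *\<^sub>R (1 / (1 + x\<^sup>2)))"
    using integrable_I0i_1_div_plus_square
    by (simp add: interval_lebesgue_integrable_def set_integrable_def zero_ereal_def)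
  then show ?thesis
    unfolding set_integrable_def
    by (rule integrable_cong_AE_imp)
       (use AE_lborel_singleton[of "0::real"] in \<open>auto simp: indicator_def elim!: eventually_mono\<close>)
qed

text \<open>
  The weights \<open>1\<close> and \<open>y\<^sup>2\<close> in the Schwartz bounds together dominate the function by a multiple of
  \<open>1 / (1 + y\<^sup>2)\<close>.
\<close>

lemma schwartz_halfline_integrable:
  assumes "\<phi> \<in> schwartz_halfline"
  shows "set_integrable lborel {0..} (halfline_deriv n \<phi>)"
proof -
  obtain B where B: "\<And>y. y \<ge> 0 \<Longrightarrow> y ^ 0 * norm (halfline_deriv n \<phi> y) \<le> B"
    using schwartz_halfline_bound[OF assms] by blast
  obtain C where C: "\<And>y. y \<ge> 0 \<Longrightarrow> y ^ 2 * norm (halfline_deriv n \<phi> y) \<le> C"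
    using schwartz_halfline_bound[OF assms] by blast
  have le: "norm (halfline_deriv n \<phi> y) \<le> (B + C) * (1 / (1 + y\<^sup>2))" if "y \<ge> 0" for y
  proof -
    have "norm (halfline_deriv n \<phi> y) * (1 + y\<^sup>2) \<le> B + C"
      using B[OF that] C[OF that] by (simp add: algebra_simps)
    then show ?thesis
      by (simp add: pos_le_divide_eq add_pos_nonneg)
  qed
  have "continuous_on {0..} (halfline_deriv n \<phi>)"
    by (rule continuous_on_vector_derivative) (use schwartz_halfline_has_derivative[OF assms] in auto)
  then have meas: "set_borel_measurable lborel {0..} (halfline_deriv n \<phi>)"
    using borel_measurable_continuous_on_indicator[of "{0::real..}" "halfline_deriv n \<phi>"]
    by (simp add: set_borel_measurable_def)
  have dom: "set_integrable lborel {0..} (\<lambda>y. (B + C) * (1 / (1 + y\<^sup>2)))"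
    by (intro set_integrable_mult_right set_integrable_inverse_1_plus_square)
  have "norm (halfline_deriv n \<phi> y) \<le> norm ((B + C) * (1 / (1 + y\<^sup>2)))" if "y \<ge> 0" for y
    using le[OF that] by (simp only: real_norm_def)
  then show ?thesis
    by (intro set_integrable_bound[OF dom meas] AE_I2 impI) simp
qed

lemma schwartz_halfline_tendsto_0:
  assumes "\<phi> \<in> schwartz_halfline"
  shows "(\<phi> \<longlongrightarrow> 0) at_top"
proof -
  obtain B where B: "\<And>y. y \<ge> 0 \<Longrightarrow> y ^ 1 * norm (halfline_deriv 0 \<phi> y) \<le> B"
    using schwartz_halfline_bound[OF assms] by blast
  have "\<forall>\<^sub>F y in at_top. norm (\<phi> y) \<le> B / y"
    using eventually_gt_at_top[of 0] by eventually_elim (use B in \<open>auto simp: field_simps\<close>)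
  moreover have "((\<lambda>y. B / y) \<longlongrightarrow> 0) at_top"
    by (rule real_tendsto_divide_at_top[OF tendsto_const filterlim_ident])
  ultimately show ?thesis
    by (rule Lim_null_comparison)
qed

text \<open>
  The iterated derivatives of a linear combination are controlled only at points \<open>y \<ge> 0\<close>, which is
  enough because a derivative within \<open>{0..}\<close> does not see values elsewhere. The second conclusion
  provides both the induction step of the first and the differentiability required of a Schwartz
  function.
\<close>

lemma halfline_deriv_lincomb:
  assumes "\<phi> \<in> schwartz_halfline" "\<psi> \<in> schwartz_halfline" "y \<ge> 0"
  shows "halfline_deriv n (\<lambda>y. a * \<phi> y + b * \<psi> y) y = a * halfline_deriv n \<phi> y + b * halfline_deriv n \<psi> y"
    and "(halfline_deriv n (\<lambda>y. a * \<phi> y + b * \<psi> y) has_vector_derivative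
            a * halfline_deriv (Suc n) \<phi> y + b * halfline_deriv (Suc n) \<psi> y) (at y within {0..})"
proof -
  let ?L = "\<lambda>n. halfline_deriv n (\<lambda>y. a * \<phi> y + b * \<psi> y)"
  let ?R = "\<lambda>n y. a * halfline_deriv n \<phi> y + b * halfline_deriv n \<psi> y"
  have deriv: "(?L n has_vector_derivative ?R (Suc n) y) (at y within {0..})"
    if "\<And>y. y \<ge> 0 \<Longrightarrow> ?L n y = ?R n y" "y \<ge> 0" for n y
  proof (rule has_vector_derivative_transform)
    show "(?R n has_vector_derivative ?R (Suc n) y) (at y within {0..})"
      using schwartz_halfline_has_derivative[OF assms(1) that(2), of n]
        schwartz_halfline_has_derivative[OF assms(2) that(2), of n]
      by (auto intro!: derivative_eq_intros simp del: halfline_deriv.simps)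
  qed (use that in auto)
  have eq: "?L n y = ?R n y" if "y \<ge> 0" for n y
    using that
  proof (induction n arbitrary: y)
    case (Suc n)
    \<comment> \<open>A derivative within a set is unique only at limit points of the set.\<close>
    have "y islimpt {0..}"
      by (rule islimpt_subset[OF islimpt_greaterThanLessThan1[of y "y + 1"]]) (use Suc.prems in auto)
    then have "at y within {0..} \<noteq> bot"
      by (simp add: trivial_limit_within)
    then show ?case
      using vector_derivative_within[OF _ deriv[OF Suc.IH Suc.prems]] by simp
  qed simp
  show "?L n y = ?R n y" "(?L n has_vector_derivative ?R (Suc n) y) (at y within {0..})"
    using eq deriv[OF eq] assms(3) by blast+
qed

lemma schwartz_halfline_lincomb:
  assumes "\<phi> \<in> schwartz_halfline" "\<psi> \<in> schwartz_halfline"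
  shows "(\<lambda>y. a * \<phi> y + b * \<psi> y) \<in> schwartz_halfline"
proof -
  note eqs = halfline_deriv_lincomb[OF assms, of _ _ a b]
  have "bounded ((\<lambda>x. of_real (x ^ k) * halfline_deriv n (\<lambda>y. a * \<phi> y + b * \<psi> y) x) ` {0..})" for n k
  proof -
    obtain B where B: "\<And>y. y \<ge> 0 \<Longrightarrow> y ^ k * norm (halfline_deriv n \<phi> y) \<le> B"
      using schwartz_halfline_bound[OF assms(1)] by blast
    obtain C where C: "\<And>y. y \<ge> 0 \<Longrightarrow> y ^ k * norm (halfline_deriv n \<psi> y) \<le> C"
      using schwartz_halfline_bound[OF assms(2)] by blast
    have "norm (of_real (y ^ k) * halfline_deriv n (\<lambda>y. a * \<phi> y + b * \<psi> y) y) \<le> norm a * B + norm b * C"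
      if y: "y \<ge> 0" for y
    proof -
      have "norm (of_real (y ^ k) * halfline_deriv n (\<lambda>y. a * \<phi> y + b * \<psi> y) y)
          = y ^ k * norm (a * halfline_deriv n \<phi> y + b * halfline_deriv n \<psi> y)"
        using y eqs(1)[OF y] by (simp add: norm_mult norm_power)
      also have "\<dots> \<le> y ^ k * (norm a * norm (halfline_deriv n \<phi> y) + norm b * norm (halfline_deriv n \<psi> y))"
        using y by (intro mult_left_mono order_trans[OF norm_triangle_ineq]) (auto simp: norm_mult)
      also have "\<dots> = norm a * (y ^ k * norm (halfline_deriv n \<phi> y)) + norm b * (y ^ k * norm (halfline_deriv n \<psi> y))"
        by (simp add: algebra_simps)
      also have "\<dots> \<le> norm a * B + norm b * C"
        by (intro add_mono mult_left_mono B C y) auto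
      finally show ?thesis .
    qed
    then show ?thesis
      unfolding bounded_iff by auto
  qed
  moreover have "halfline_deriv n (\<lambda>y. a * \<phi> y + b * \<psi> y) differentiable (at y within {0..})"
    if "y \<ge> 0" for n y
    using eqs(2)[OF that] by (rule differentiableI_vector)
  ultimately show ?thesis
    unfolding schwartz_halfline_def by blast
qed

section \<open>The Dirichlet kernel\<close>

lemma tendsto_Si_scaled:
  assumes "t \<noteq> 0"
  shows "((\<lambda>N. Si (N * t)) \<longlongrightarrow> sgn t * (pi / 2)) at_top"
proof (cases "t > 0")
  case True
  have "filterlim (\<lambda>N. N * t) at_top at_top"
    using True by (simp add: filterlim_tendsto_pos_mult_at_top filterlim_at_top_mult_tendsto_pos[OF tendsto_const] filterlim_ident)
  from filterlim_compose[OF Si_at_top this] show ?thesis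
    using True by simp
next
  case False
  then have t: "t < 0" using assms by simp
  have "filterlim (\<lambda>N. N * (-t)) at_top at_top"
    using t by (intro filterlim_at_top_mult_tendsto_pos[OF tendsto_const] filterlim_ident) auto
  from tendsto_minus[OF filterlim_compose[OF Si_at_top this]]
  have "((\<lambda>N. - Si (N * (- t))) \<longlongrightarrow> - (pi / 2)) at_top" .
  moreover have "\<forall>\<^sub>F N in at_top. - Si (N * (- t)) = Si (N * t)"
    using eventually_ge_at_top[of 0]
    by eventually_elim (use t in \<open>simp add: Si_neg[symmetric] mult_nonneg_nonpos\<close>)
  ultimately have "((\<lambda>N. Si (N * t)) \<longlongrightarrow> - (pi / 2)) at_top"
    by (rule Lim_transform_eventually)
  then show ?thesis
    using t by simp
qed

text \<open>
  Integration by parts turns the kernel, which is not uniformly integrable in \<open>N\<close>, into the bounded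
  function \<open>Si (N (y - x))\<close> against \<open>\<phi>'\<close>. In the limit the boundary term at \<open>0\<close> gives \<open>\<pi> \<phi> 0 / 2\<close> and
  the integral of \<open>\<phi>' y sgn (y - x) \<pi> / 2\<close> gives \<open>\<pi> (\<phi> 0 - 2 \<phi> x) / 2\<close>, to be subtracted. The
  boundary term would have the opposite sign for \<open>x < 0\<close>, and the limit would then be \<open>0\<close>.
\<close>

lemma Dirichlet_kernel_limit:
  fixes \<phi> \<phi>' :: "real \<Rightarrow> complex"
  assumes der: "\<And>y. y \<ge> 0 \<Longrightarrow> (\<phi> has_vector_derivative \<phi>' y) (at y within {0..})"
    and int: "set_integrable lborel {0..} \<phi>" and int': "set_integrable lborel {0..} \<phi>'"
    and lim: "(\<phi> \<longlongrightarrow> 0) at_top"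
    and x: "x > 0"
  shows "((\<lambda>N. LINT y:{0..}|lborel. \<phi> y * of_real (N * sinc (N * (y - x)))) \<longlongrightarrow> of_real pi * \<phi> x) at_top"
proof -
  obtain B where B: "\<And>t. \<bar>Si t\<bar> \<le> B" using bounded_Si by auto
  have int'_Si: "set_integrable lborel {0..} (\<lambda>y. \<phi>' y * of_real (Si (N * (y - x))))" for N
    by (rule set_integrable_mult_bounded[OF int', where B = B]) (auto simp: B)
  have sinc_le: "\<bar>sinc t\<bar> \<le> 1" for t :: real
    using abs_sin_x_le_abs_x[of t] by (auto simp: divide_le_eq_1)
  have int_sinc: "set_integrable lborel {0..} (\<lambda>y. \<phi> y * of_real (N * sinc (N * (y - x))))" for N
  proof (rule set_integrable_mult_bounded[OF int, where B = "\<bar>N\<bar>"])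
    show "(\<lambda>y. complex_of_real (N * sinc (N * (y - x)))) \<in> borel_measurable borel"
      by (intro borel_measurable_continuous_onI continuous_intros)
    show "norm (complex_of_real (N * sinc (N * (y - x)))) \<le> \<bar>N\<bar>" for y
      using mult_left_mono[OF sinc_le[of "N * (y - x)"], of "\<bar>N\<bar>"]
      by (simp only: norm_of_real abs_mult) simp
  qed
  have parts: "(LINT y:{0..}|lborel. \<phi> y * of_real (N * sinc (N * (y - x)))) =
      - \<phi> 0 * of_real (Si (N * (0 - x))) - (LINT y:{0..}|lborel. \<phi>' y * of_real (Si (N * (y - x))))" for N
  proof -
    let ?H = "\<lambda>y. \<phi> y * of_real (Si (N * (y - x)))"
    have "(?H has_vector_derivative \<phi> y * of_real (N * sinc (N * (y - x))) + \<phi>' y * of_real (Si (N * (y - x))))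
        (at y within {0..})" if "y \<ge> 0" for y
    proof -
      have "((\<lambda>y. Si (N * (y - x))) has_real_derivative sinc (N * (y - x)) * N) (at y within {0..})"
        by (rule DERIV_chain2[OF DERIV_Si]) (auto intro!: derivative_eq_intros)
      then have "((\<lambda>y. Si (N * (y - x))) has_real_derivative N * sinc (N * (y - x))) (at y within {0..})"
        by (simp only: mult.commute)
      from has_vector_derivative_mult[OF der[OF that] has_vector_derivative_of_real[OF this]]
      show ?thesis .
    qed
    moreover have "(?H \<longlongrightarrow> 0) at_top"
    proof (rule Lim_null_comparison)
      show "\<forall>\<^sub>F y in at_top. norm (?H y) \<le> norm (\<phi> y) * B"
        by (intro always_eventually allI) (simp add: norm_mult B mult_left_mono)
      show "((\<lambda>y. norm (\<phi> y) * B) \<longlongrightarrow> 0) at_top"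
        using tendsto_mult_right[OF tendsto_norm[OF lim], of B] by simp
    qed
    ultimately have "(LINT y:{0..}|lborel. \<phi> y * of_real (N * sinc (N * (y - x)))
         + \<phi>' y * of_real (Si (N * (y - x)))) = - ?H 0"
      by (intro set_integral_halfline_derivative set_integral_add(1) int_sinc int'_Si)
    then show ?thesis
      by (simp only: set_integral_add(2)[OF int_sinc int'_Si]) (simp add: algebra_simps)
  qed
  have pieces: "(LINT y:{0..}|lborel. \<phi>' y) = - \<phi> 0" "(LINT y:{x..}|lborel. \<phi>' y) = - \<phi> x"
    and int'_x: "set_integrable lborel {x..} \<phi>'"
  proof -
    show "(LINT y:{0..}|lborel. \<phi>' y) = - \<phi> 0"
      by (rule set_integral_halfline_derivative[OF der int' lim])
    show *: "set_integrable lborel {x..} \<phi>'"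
      by (rule set_integrable_subset[OF int']) (use x in auto)
    show "(LINT y:{x..}|lborel. \<phi>' y) = - \<phi> x"
      by (rule set_integral_halfline_derivative[OF _ * lim])
         (use x in \<open>auto intro: has_vector_derivative_within_subset[OF der]\<close>)
  qed
  let ?f' = "\<lambda>y. indicat_real {0..} y *\<^sub>R \<phi>' y"
  \<comment> \<open>The pointwise limit, with \<open>sgn (y - x)\<close> written as \<open>2 * indicator {x..} y - 1\<close> so that its
    integral splits into the two integrals computed above; the two agree except at \<open>y = x\<close>.\<close>
  let ?g = "\<lambda>y. of_real (pi / 2) * (2 * (indicat_real {x..} y *\<^sub>R \<phi>' y) - ?f' y)"
  have i0: "integrable lborel ?f'" and ix: "integrable lborel (\<lambda>y. indicat_real {x..} y *\<^sub>R \<phi>' y)"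
    using int' int'_x by (simp_all add: set_integrable_def)
  have [measurable]: "?f' \<in> borel_measurable borel" "(\<lambda>y. indicat_real {x..} y *\<^sub>R \<phi>' y) \<in> borel_measurable borel"
    using borel_measurable_integrable[OF i0] borel_measurable_integrable[OF ix] by simp_all
  have "((\<lambda>N. LINT y|lborel. ?f' y * of_real (Si (N * (y - x)))) \<longlongrightarrow> (LINT y|lborel. ?g y)) at_top"
  proof (rule integral_dominated_convergence_at_top)
    show "?g \<in> borel_measurable lborel" by measurable
    show "(\<lambda>y. ?f' y * of_real (Si (N * (y - x)))) \<in> borel_measurable lborel" for N by measurable
    show "integrable lborel (\<lambda>y. B * norm (?f' y))"
      by (intro integrable_mult_right integrable_norm i0)
    show "\<forall>\<^sub>F N in at_top. AE y in lborel. norm (?f' y * of_real (Si (N * (y - x)))) \<le> B * norm (?f' y)"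
      by (intro always_eventually allI AE_I2)
         (simp add: norm_mult mult.commute[of B] mult_left_mono B mult.assoc)
    show "AE y in lborel. ((\<lambda>N. ?f' y * of_real (Si (N * (y - x)))) \<longlongrightarrow> ?g y) at_top"
      using AE_lborel_singleton[of x]
    proof eventually_elim
      case (elim y)
      then have "((\<lambda>N. Si (N * (y - x))) \<longlongrightarrow> sgn (y - x) * (pi / 2)) at_top"
        by (intro tendsto_Si_scaled) auto
      then have "((\<lambda>N. ?f' y * of_real (Si (N * (y - x)))) \<longlongrightarrow> ?f' y * of_real (sgn (y - x) * (pi / 2))) at_top"
        by (intro tendsto_intros)
      moreover have "?f' y * of_real (sgn (y - x) * (pi / 2)) = ?g y"
        using elim x by (auto simp: indicator_def sgn_if)
      ultimately show ?case by (simp only:)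
    qed
  qed
  moreover have "(LINT y|lborel. ?g y) = of_real (pi / 2) * (2 * (- \<phi> x) - (- \<phi> 0))"
    unfolding pieces(1,2)[symmetric] set_lebesgue_integral_def using i0 ix
    by (simp only: integral_mult_right_zero Bochner_Integration.integral_diff integrable_mult_right)
  ultimately have "((\<lambda>N. LINT y:{0..}|lborel. \<phi>' y * of_real (Si (N * (y - x)))) \<longlongrightarrow>
      of_real (pi / 2) * (\<phi> 0 - 2 * \<phi> x)) at_top"
    by (simp add: set_lebesgue_integral_def)
  moreover have "((\<lambda>N. Si (N * (0 - x))) \<longlongrightarrow> - (pi / 2)) at_top"
    using tendsto_Si_scaled[of "0 - x"] x by simp
  ultimately have "((\<lambda>N. LINT y:{0..}|lborel. \<phi> y * of_real (N * sinc (N * (y - x)))) \<longlongrightarrow>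
      - \<phi> 0 * of_real (- (pi / 2)) - of_real (pi / 2) * (\<phi> 0 - 2 * \<phi> x)) at_top"
    unfolding parts by (intro tendsto_intros)
  then show ?thesis
    by (simp add: algebra_simps)
qed


section \<open>Integrating a parameter integral along a contour\<close>

text \<open>
  A bounded, jointly continuous kernel on a segment times an integrable function is dominated by an
  integrable function of both variables, since the segment has finite length. The second conclusion
  is stated as well because it is needed to add the contributions of consecutive segments.
\<close>

lemma has_contour_integral_linepath_Fubini:
  fixes K :: "complex \<Rightarrow> real \<Rightarrow> complex"
  assumes \<phi>: "set_integrable lborel A \<phi>"
    and cont: "continuous_on UNIV (\<lambda>(l, y). K l y)"
    and bound: "\<And>l y. l \<in> closed_segment p q \<Longrightarrow> y \<in> A \<Longrightarrow> norm (K l y) \<le> M"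
  shows "((\<lambda>l. LINT y:A|lborel. \<phi> y * K l y) has_contour_integral
           (LINT y:A|lborel. \<phi> y * contour_integral (linepath p q) (\<lambda>l. K l y))) (linepath p q)"
    and "set_integrable lborel A (\<lambda>y. \<phi> y * contour_integral (linepath p q) (\<lambda>l. K l y))"
proof -
  define f where "f = (\<lambda>y. indicat_real A y *\<^sub>R \<phi> y)"
  define k where "k = (\<lambda>t y. K (linepath p q t) y * (q - p))"
  define F where "F = (\<lambda>t y. indicat_real {0..1} t *\<^sub>R (f y * k t y))"
  have f: "integrable lborel f"
    using \<phi> by (simp add: f_def set_integrable_def)
  have f_meas [measurable]: "f \<in> borel_measurable borel"
    using borel_measurable_integrable[OF f] by simp
  have k_cont: "continuous_on UNIV (\<lambda>p. k (fst p) (snd p))"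
  proof -
    have "continuous_on UNIV (\<lambda>z :: real \<times> real. (linepath p q (fst z), snd z))"
      unfolding linepath_def by (intro continuous_intros)
    from continuous_on_compose2[OF cont this]
    have "continuous_on UNIV (\<lambda>z. K (linepath p q (fst z)) (snd z))" by simp
    then show ?thesis
      unfolding k_def by (intro continuous_intros)
  qed
  then have k_meas: "(\<lambda>p. k (fst p) (snd p)) \<in> borel_measurable (borel \<Otimes>\<^sub>M borel)"
    using borel_measurable_continuous_onI by (simp add: borel_prod)
  have F_meas: "(\<lambda>p. F (fst p) (snd p)) \<in> borel_measurable (lborel \<Otimes>\<^sub>M lborel)"
    unfolding F_def using k_meas by measurable
  have k_bound: "norm (k t y) \<le> M * norm (q - p)" if "t \<in> {0..1}" "y \<in> A" for t y
    unfolding k_def norm_mult using that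
    by (intro mult_right_mono bound) (auto simp: linepath_in_path)
  have dom: "integrable (lborel \<Otimes>\<^sub>M lborel) (\<lambda>(t :: real, y). indicat_real {0..1} t * (M * norm (q - p) * norm (f y)))"
  proof (rule lborel_pair.Fubini_integrable)
    have "(\<lambda>z :: real \<times> real. indicat_real {0..1} (fst z) * (M * norm (q - p) * norm (f (snd z))))
        \<in> borel_measurable (lborel \<Otimes>\<^sub>M lborel)"
      by measurable
    then show "(\<lambda>(t :: real, y). indicat_real {0..1} t * (M * norm (q - p) * norm (f y)))
        \<in> borel_measurable (lborel \<Otimes>\<^sub>M lborel)"
      by (simp only: case_prod_beta')
    have "integrable lborel (\<lambda>t :: real. indicat_real {0..1} t *
        (LINT y|lborel. \<bar>M\<bar> * norm (q - p) * norm (f y)))"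
      by (intro integrable_mult_left integrable_real_indicator) auto
    then show "integrable lborel (\<lambda>t :: real. LINT y|lborel.
        norm (case (t, y) of (t, y) \<Rightarrow> indicat_real {0..1} t * (M * norm (q - p) * norm (f y))))"
      by (simp only: prod.case real_norm_def abs_mult abs_norm_cancel abs_indicator integral_mult_right_zero)
    show "AE t in lborel. integrable lborel
        (\<lambda>y. case (t, y) of (t, y) \<Rightarrow> indicat_real {0..1} t * (M * norm (q - p) * norm (f y)))"
      using f by (intro AE_I2) simp
  qed
  have F_int: "integrable (lborel \<Otimes>\<^sub>M lborel) (\<lambda>(t, y). F t y)"
  proof (rule Bochner_Integration.integrable_bound[OF dom])
    show "(\<lambda>(t, y). F t y) \<in> borel_measurable (lborel \<Otimes>\<^sub>M lborel)"
      using F_meas by (simp add: case_prod_beta')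
    show "AE z in lborel \<Otimes>\<^sub>M lborel. norm (case z of (t, y) \<Rightarrow> F t y) \<le>
        norm (case z of (t, y) \<Rightarrow> indicat_real {0..1} t * (M * norm (q - p) * norm (f y)))"
    proof (rule AE_I2, clarify)
      fix t y
      have "norm (f y) * norm (k t y) \<le> norm (f y) * \<bar>M * norm (q - p)\<bar>" if "t \<in> {0..1}" "y \<in> A"
        using k_bound[OF that] by (intro mult_left_mono) auto
      then show "norm (F t y) \<le> norm (indicat_real {0..1} t * (M * norm (q - p) * norm (f y)))"
        by (auto simp: F_def f_def indicator_def norm_mult abs_mult mult_ac)
    qed
  qed
  let ?g = "\<lambda>l. LINT y:A|lborel. \<phi> y * K l y"
  \<comment> \<open>The two iterated integrals of \<open>F\<close> are the two sides of the claim.\<close>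
  have inner_y: "(LINT y|lborel. F t y) = indicat_real {0..1} t *\<^sub>R (?g (linepath p q t) * (q - p))" for t
  proof -
    have "(LINT y|lborel. F t y) = (LINT y|lborel. indicat_real {0..1} t *\<^sub>R
        ((indicat_real A y *\<^sub>R (\<phi> y * K (linepath p q t) y)) * (q - p)))"
      by (intro Bochner_Integration.integral_cong) (auto simp: F_def f_def k_def)
    then show ?thesis
      by (simp only: set_lebesgue_integral_def integral_scaleR_right integral_mult_left_zero)
  qed
  have inner_t: "(LINT t|lborel. F t y) =
      indicat_real A y *\<^sub>R (\<phi> y * contour_integral (linepath p q) (\<lambda>l. K l y))" for y
  proof -
    have "continuous_on UNIV (\<lambda>l :: complex. (l, y))"
      by (intro continuous_intros)
    from continuous_on_compose2[OF cont this] have "continuous_on UNIV (\<lambda>l. K l y)"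
      by simp
    from continuous_on_subset[OF this subset_UNIV] have "(\<lambda>l. K l y) contour_integrable_on linepath p q"
      by (rule contour_integrable_continuous_linepath)
    from has_contour_integral_integral[OF this] have *: "((\<lambda>t. k t y) has_integral contour_integral (linepath p q) (\<lambda>l. K l y)) {0..1}"
      by (simp only: k_def has_contour_integral_linepath)
    have "continuous_on {0..1} (\<lambda>t :: real. (t, y))"
      by (intro continuous_intros)
    from continuous_on_compose2[OF k_cont this] have "continuous_on {0..1} (\<lambda>t. k t y)"
      by simp
    then have "set_integrable lborel {0..1} (\<lambda>t. k t y)"
      unfolding set_integrable_def by (rule borel_integrable_compact[OF compact_Icc])
    then have "(LINT t:{0..1}|lborel. k t y) = contour_integral (linepath p q) (\<lambda>l. K l y)"
      using * by (simp add: set_borel_integral_eq_integral(2) integral_unique)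
    moreover have "(LINT t|lborel. F t y) = f y * (LINT t:{0..1}|lborel. k t y)"
    proof -
      have "(LINT t|lborel. F t y) = (LINT t|lborel. f y * (indicat_real {0..1} t *\<^sub>R k t y))"
        by (intro Bochner_Integration.integral_cong) (auto simp: F_def)
      then show ?thesis by (simp only: set_lebesgue_integral_def integral_mult_right_zero)
    qed
    ultimately show ?thesis by (simp add: f_def)
  qed
  have int_t: "set_integrable lborel {0..1} (\<lambda>t. ?g (linepath p q t) * (q - p))"
    using lborel_pair.integrable_fst[OF F_int] by (simp only: inner_y set_integrable_def)
  have "((\<lambda>t. ?g (linepath p q t) * (q - p)) has_integral
      (LINT t:{0..1}|lborel. ?g (linepath p q t) * (q - p))) {0..1}"
    unfolding set_borel_integral_eq_integral(2)[OF int_t]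
    by (rule integrable_integral[OF set_borel_integral_eq_integral(1)[OF int_t]])
  also have "(LINT t:{0..1}|lborel. ?g (linepath p q t) * (q - p)) =
      (LINT y:A|lborel. \<phi> y * contour_integral (linepath p q) (\<lambda>l. K l y))"
    using lborel_pair.Fubini_integral[OF F_int, symmetric]
    unfolding inner_y inner_t by (simp only: set_lebesgue_integral_def)
  finally show "((\<lambda>l. LINT y:A|lborel. \<phi> y * K l y) has_contour_integral
      (LINT y:A|lborel. \<phi> y * contour_integral (linepath p q) (\<lambda>l. K l y))) (linepath p q)"
    by (simp only: has_contour_integral_linepath)
  show "set_integrable lborel A (\<lambda>y. \<phi> y * contour_integral (linepath p q) (\<lambda>l. K l y))"
    using lborel_pair.integrable_snd[OF F_int] by (simp only: inner_t set_integrable_def)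
qed

lemma has_contour_integral_exp:
  assumes "c \<noteq> 0" "valid_path g"
  shows "((\<lambda>l. exp (l * c)) has_contour_integral (exp (pathfinish g * c) - exp (pathstart g * c)) / c) g"
proof -
  have "((\<lambda>l. exp (l * c) / c) has_field_derivative exp (l * c)) (at l within UNIV)" for l
    using assms(1) by (auto intro!: derivative_eq_intros)
  from contour_integral_primitive[OF this assms(2)] show ?thesis
    by (simp add: diff_divide_distrib)
qed

lemma set_integrable_mult_kernel:
  fixes \<phi> :: "real \<Rightarrow> complex"
  assumes "set_integrable lborel A \<phi>" "continuous_on UNIV k" "\<And>y. y \<in> A \<Longrightarrow> norm (k y) \<le> M"
  shows "set_integrable lborel A (\<lambda>y. \<phi> y * k y)"
  using assms by (intro set_integrable_mult_bounded[where B = M] borel_measurable_continuous_onI)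

section \<open>The integral over the real line\<close>

text \<open>
  Writing the Dirichlet kernel with \<open>sinc\<close> makes the formula hold at \<open>y = x\<close> too and exhibits it as the
  derivative of the sine integral.
\<close>

lemma contour_integral_real_kernel:
  "contour_integral (contour_real N) (\<lambda>l. exp (\<i> * l * of_real x) * exp (- \<i> * l * of_real y)) =
     2 * of_real (N * sinc (N * (y - x)))"
proof (cases "x = y")
  case True
  then have "(\<lambda>l. exp (\<i> * l * of_real x) * exp (- \<i> * l * of_real y)) = (\<lambda>l. 1)"
    by (auto simp flip: exp_add)
  then show ?thesis
    using True by (simp add: contour_real_def)
next
  case False
  define c where "c = \<i> * of_real (x - y)"
  have c: "c \<noteq> 0" using False by (simp add: c_def)
  have "(\<lambda>l. exp (\<i> * l * of_real x) * exp (- \<i> * l * of_real y)) = (\<lambda>l. exp (l * c))"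
    by (auto simp: c_def algebra_simps simp flip: exp_add)
  then have "contour_integral (contour_real N) (\<lambda>l. exp (\<i> * l * of_real x) * exp (- \<i> * l * of_real y)) =
      (exp (of_real N * c) - exp (- of_real N * c)) / c"
    using contour_integral_unique[OF has_contour_integral_exp[OF c, of "contour_real N"]]
    by (simp add: contour_real_def)
  also have "\<dots> = 2 * \<i> * sin (of_real (N * (x - y))) / c"
  proof -
    have "exp (\<i> * z) - exp (- (\<i> * z)) = 2 * \<i> * sin z" for z :: complex
      by (simp add: sin_exp_eq)
    from this[of "of_real (N * (x - y))"] show ?thesis
      by (simp add: c_def mult.left_commute[of \<i>])
  qed
  also have "\<dots> = 2 * \<i> * of_real (sin (N * (x - y))) / c"
    by (simp only: sin_of_real)
  also have "\<dots> = 2 * of_real (sin (N * (x - y)) / (x - y))"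
    using False by (simp add: c_def)
  also have "sin (N * (x - y)) / (x - y) = N * sinc (N * (y - x))"
    using False sin_minus[of "N * (y - x)"] by (auto simp: field_simps)
  finally show ?thesis .
qed

lemma real_line_part_of_inversion:
  assumes \<phi>: "\<phi> \<in> schwartz_halfline" and x: "x > 0"
  shows "(\<lambda>l. exp (\<i> * l * of_real x) * fst (transform \<phi>) l) contour_integrable_on contour_real N"
    and "((\<lambda>N. contour_integral (contour_real N) (\<lambda>l. exp (\<i> * l * of_real x) * fst (transform \<phi>) l))
           \<longlongrightarrow> 2 * of_real pi * \<phi> x) at_top"
proof -
  define K where "K = (\<lambda>l y. exp (\<i> * l * of_real x) * exp (- \<i> * l * of_real y))"
  have int: "set_integrable lborel {0..} \<phi>"
    using schwartz_halfline_integrable[OF \<phi>, of 0] by simp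
  have eq: "(\<lambda>l. exp (\<i> * l * of_real x) * fst (transform \<phi>) l) = (\<lambda>l. LINT y:{0..}|lborel. \<phi> y * K l y)"
    by (simp add: transform_def K_def mult_ac flip: set_integral_mult_right)
  have K_bound: "norm (K l y) \<le> 1" if "l \<in> closed_segment (- of_real N) (of_real N)" for l y N
  proof -
    have "Im l = 0"
      using that by (auto simp: in_segment)
    then show ?thesis by (simp add: K_def norm_mult norm_exp_eq_Re)
  qed
  have "((\<lambda>l. LINT y:{0..}|lborel. \<phi> y * K l y) has_contour_integral
      (LINT y:{0..}|lborel. \<phi> y * contour_integral (contour_real N) (\<lambda>l. K l y))) (contour_real N)" for N
    unfolding contour_real_def
    by (rule has_contour_integral_linepath_Fubini(1)[OF int _ K_bound])
       (auto simp: K_def case_prod_beta' intro!: continuous_intros)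
  also have "(LINT y:{0..}|lborel. \<phi> y * contour_integral (contour_real N) (\<lambda>l. K l y)) =
      2 * (LINT y:{0..}|lborel. \<phi> y * of_real (N * sinc (N * (y - x))))" for N
    unfolding K_def contour_integral_real_kernel
    by (simp only: mult.left_commute[of _ 2] set_integral_mult_right)
  finally have *: "((\<lambda>l. exp (\<i> * l * of_real x) * fst (transform \<phi>) l) has_contour_integral
      2 * (LINT y:{0..}|lborel. \<phi> y * of_real (N * sinc (N * (y - x))))) (contour_real N)" for N
    unfolding eq .
  then show "(\<lambda>l. exp (\<i> * l * of_real x) * fst (transform \<phi>) l) contour_integrable_on contour_real N"
    by (auto simp: contour_integrable_on_def)
  have "((\<lambda>N. LINT y:{0..}|lborel. \<phi> y * of_real (N * sinc (N * (y - x)))) \<longlongrightarrow> of_real pi * \<phi> x) at_top"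
    using schwartz_halfline_has_derivative[OF \<phi>, of _ 0] schwartz_halfline_integrable[OF \<phi>, of "Suc 0"]
    by (intro Dirichlet_kernel_limit[where \<phi>' = "halfline_deriv (Suc 0) \<phi>"] int x
          schwartz_halfline_tendsto_0[OF \<phi>]) simp_all
  then have "((\<lambda>N. 2 * (LINT y:{0..}|lborel. \<phi> y * of_real (N * sinc (N * (y - x))))) \<longlongrightarrow>
      2 * (of_real pi * \<phi> x)) at_top"
    by (intro tendsto_intros)
  then show "((\<lambda>N. contour_integral (contour_real N) (\<lambda>l. exp (\<i> * l * of_real x) * fst (transform \<phi>) l))
           \<longlongrightarrow> 2 * of_real pi * \<phi> x) at_top"
    unfolding contour_integral_unique[OF *] by (simp only: mult.assoc)
qed

section \<open>The integral over the boundary of the sector\<close>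

lemma alpha_eq: "alpha = Complex (- 1 / 2) (sqrt 3 / 2)"
  and alpha_sq_eq: "alpha\<^sup>2 = Complex (- 1 / 2) (- sqrt 3 / 2)"
proof -
  have "alpha = cis (2 * pi / 3)"
    by (simp add: alpha_def cis_conv_exp mult_ac)
  then show a: "alpha = Complex (- 1 / 2) (sqrt 3 / 2)"
    by (simp add: complex_eq_iff cos_120 sin_120)
  show "alpha\<^sup>2 = Complex (- 1 / 2) (- sqrt 3 / 2)"
    by (simp add: a power2_eq_square complex_eq_iff)
qed

lemma exp_pi_third_eq: "exp (of_real pi * \<i> / 3) = - alpha\<^sup>2"
proof -
  have "exp (of_real pi * \<i> / 3) = cis (pi / 3)"
    by (simp add: cis_conv_exp mult_ac)
  then show ?thesis
    by (simp add: alpha_sq_eq complex_eq_iff cos_60 sin_60)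
qed

text \<open>
  The closed convex cone on which both exponentials in the second formula of the transform stay
  bounded for all \<open>y \<ge> 0\<close>. It is described by linear inequalities rather than by arguments so that
  closedness and convexity are immediate, and so that \<open>0\<close> is included.
\<close>

definition decay_cone :: "complex set" where
  "decay_cone = {l. Im (alpha * l) \<le> 0 \<and> Im (alpha\<^sup>2 * l) \<le> 0}"

lemma convex_decay_cone: "convex decay_cone"
proof -
  have eq: "decay_cone = (\<lambda>l. alpha * l) -` {z. Im z \<le> 0} \<inter> (\<lambda>l. alpha\<^sup>2 * l) -` {z. Im z \<le> 0}"
    by (auto simp: decay_cone_def)
  show ?thesis
    unfolding eq by (intro convex_Int convex_linear_vimage convex_halfspace_Im_le
          bounded_linear.linear[OF bounded_linear_mult_right])
qed

text \<open>
  For \<open>l\<close> in the open sector, multiplication by \<open>\<alpha>\<close> and \<open>\<alpha>\<^sup>2\<close> turns the argument into the intervals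
  \<open>(\<pi>, 4\<pi>/3)\<close> and \<open>(5\<pi>/3, 2\<pi>)\<close>, both in the lower half-plane; the closed cone then contains the
  closure of the sector.
\<close>

lemma frontier_D_plus_subset: "frontier D_plus \<subseteq> decay_cone"
proof -
  have "D_plus \<subseteq> decay_cone"
  proof
    fix l assume l: "l \<in> D_plus"
    have pol: "l = of_real (norm l) * cis (Arg l)"
      using rcis_cmod_Arg[of l] by (simp add: rcis_def)
    have a: "alpha = cis (2 * pi / 3)" "alpha\<^sup>2 = cis (4 * pi / 3)"
      by (simp_all add: alpha_def cis_conv_exp mult_ac DeMoivre flip: exp_of_nat_mult)
    have 1: "alpha * l = of_real (norm l) * cis (Arg l + 2 * pi / 3)"
      by (subst pol) (simp add: a cis_mult mult_ac add_ac)
    have 2: "alpha\<^sup>2 * l = of_real (norm l) * cis (Arg l + 4 * pi / 3)"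
      by (subst pol) (simp only: a(2) mult.left_commute[of "cis _"] cis_mult add.commute)
    have "Im (alpha * l) = norm l * sin (Arg l + 2 * pi / 3)"
      "Im (alpha\<^sup>2 * l) = norm l * sin (Arg l + 4 * pi / 3)"
      unfolding 1 2 by simp_all
    moreover have "sin (Arg l + 2 * pi / 3) \<le> 0" "sin (Arg l + 4 * pi / 3) \<le> 0"
      using l by (auto simp: D_plus_def intro!: sin_le_zero)
    ultimately show "l \<in> decay_cone"
      unfolding decay_cone_def by (simp only: mem_Collect_eq mult_nonneg_nonpos norm_ge_zero)
  qed
  moreover have "closed decay_cone"
    unfolding decay_cone_def by (intro closed_Collect_conj closed_Collect_le continuous_intros)
  ultimately have "closure D_plus \<subseteq> decay_cone"
    by (rule closure_minimal)
  then show ?thesis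
    by (auto simp: frontier_def)
qed

text \<open>
  The endpoints of the truncated contour are \<open>N \<alpha>\<close> and \<open>- N \<alpha>\<^sup>2\<close>, because
  \<open>exp (\<pi> \<i> / 3) = - \<alpha>\<^sup>2\<close>.
\<close>

lemma sector_rays_in_decay_cone:
  assumes "N \<ge> 0"
  shows "closed_segment (of_real N * alpha) 0 \<subseteq> decay_cone"
    and "closed_segment 0 (- of_real N * alpha\<^sup>2) \<subseteq> decay_cone"
proof -
  have "of_real N * alpha \<in> decay_cone"
    unfolding decay_cone_def alpha_sq_eq using assms by (simp add: alpha_eq)
  moreover have "- of_real N * alpha\<^sup>2 \<in> decay_cone"
    unfolding decay_cone_def alpha_sq_eq using assms by (simp add: alpha_eq)
  moreover have "0 \<in> decay_cone"
    by (simp add: decay_cone_def)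
  ultimately show "closed_segment (of_real N * alpha) 0 \<subseteq> decay_cone"
    "closed_segment 0 (- of_real N * alpha\<^sup>2) \<subseteq> decay_cone"
    by (simp_all only: closed_segment_subset convex_decay_cone)
qed

definition sector_kernel :: "complex \<Rightarrow> real \<Rightarrow> complex" where
  "sector_kernel l y = alpha\<^sup>2 * exp (- \<i> * alpha * l * of_real y) + alpha * exp (- \<i> * alpha\<^sup>2 * l * of_real y)"

lemma norm_alpha: "norm alpha = 1"
  by (simp add: alpha_def norm_exp_eq_Re)

lemma norm_sector_kernel_le:
  assumes "l \<in> decay_cone" "y \<ge> 0"
  shows "norm (sector_kernel l y) \<le> 2"
proof -
  have *: "norm (exp (- \<i> * \<beta> * l * of_real y)) \<le> 1" if "Im (\<beta> * l) \<le> 0" for \<beta>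
  proof -
    have "Re (- \<i> * \<beta> * l * of_real y) = Im (\<beta> * l) * y"
      by (simp add: algebra_simps)
    then show ?thesis
      using that assms(2) by (simp add: norm_exp_eq_Re mult_nonpos_nonneg)
  qed
  have "norm (sector_kernel l y) \<le> norm (exp (- \<i> * alpha * l * of_real y)) + norm (exp (- \<i> * alpha\<^sup>2 * l * of_real y))"
    unfolding sector_kernel_def by (rule order_trans[OF norm_triangle_ineq]) (simp add: norm_mult norm_power norm_alpha)
  also have "\<dots> \<le> 1 + 1"
    using assms by (intro add_mono *) (auto simp: decay_cone_def)
  finally show ?thesis by simp
qed

lemma snd_transform: "snd (transform \<phi>) l = (LINT y:{0..}|lborel. \<phi> y * sector_kernel l y)"
  by (simp add: transform_def sector_kernel_def)


text \<open>
  The primitive of \<open>exp (\<i> l (x - \<beta> y))\<close> is itself divided by \<open>c \<beta> = \<i> (x - \<beta> y)\<close>. At an endpoint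
  \<open>l\<close> of the contour its exponential factors into \<open>exp (\<i> l x)\<close>, of modulus
  \<open>exp (- \<surd>3 x N / 2)\<close>, and \<open>exp (- \<i> \<beta> l y)\<close>, of modulus at most \<open>1\<close> on the cone. Two endpoints and two
  values of \<open>\<beta>\<close> account for the factor \<open>4\<close>.
\<close>

lemma norm_contour_integral_sector_kernel_le:
  assumes x: "x > 0" and y: "y \<ge> 0" and N: "N \<ge> 0"
  shows "norm (contour_integral (contour_D_plus N) (\<lambda>l. exp (\<i> * l * of_real x) * sector_kernel l y))
           \<le> 4 / x * exp (- (sqrt 3 / 2 * x * N))"
proof -
  let ?p = "of_real N * alpha" and ?q = "- of_real N * alpha\<^sup>2"
  have ends: "pathstart (contour_D_plus N) = ?p" "pathfinish (contour_D_plus N) = ?q"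
    and valid: "valid_path (contour_D_plus N)"
    by (simp_all add: contour_D_plus_def exp_pi_third_eq flip: alpha_def)
  have in_cone: "?p \<in> decay_cone" "?q \<in> decay_cone"
    using sector_rays_in_decay_cone[OF N] ends_in_segment by blast+
  have Im_ends: "Im ?p = sqrt 3 / 2 * N" "Im ?q = sqrt 3 / 2 * N"
    by (simp add: alpha_eq) (simp add: alpha_sq_eq)
  define c where "c = (\<lambda>\<beta>. \<i> * (of_real x - \<beta> * of_real y))"
  have c_le: "x \<le> norm (c \<beta>)" if "Re \<beta> = - 1 / 2" for \<beta>
  proof -
    have "x \<le> Re (of_real x - \<beta> * of_real y)"
      using that y by simp
    also have "\<dots> \<le> norm (of_real x - \<beta> * of_real y)"
      by (rule complex_Re_le_cmod)
    also have "\<dots> = norm (c \<beta>)"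
      by (simp add: c_def norm_mult)
    finally show ?thesis .
  qed
  have exp_le: "norm (exp (l * c \<beta>)) \<le> exp (- (sqrt 3 / 2 * x * N))"
    if "Im l = sqrt 3 / 2 * N" "Im (\<beta> * l) \<le> 0" for l \<beta>
  proof -
    have "Re (l * c \<beta>) = Im (\<beta> * l) * y - Im l * x"
      by (simp add: c_def algebra_simps)
    also have "\<dots> \<le> - (Im l * x)"
      using that(2) y by (simp add: mult_nonpos_nonneg del: times_complex.sel)
    finally have "Re (l * c \<beta>) \<le> - (sqrt 3 / 2 * x * N)"
      by (simp only: that(1) mult_ac)
    then show ?thesis
      by (simp only: norm_exp_eq_Re exp_le_cancel_iff)
  qed
  define I where "I = (\<lambda>\<beta>. (exp (?q * c \<beta>) - exp (?p * c \<beta>)) / c \<beta>)"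
  have I_le: "norm (I \<beta>) \<le> 2 / x * exp (- (sqrt 3 / 2 * x * N))"
    if "Re \<beta> = - 1 / 2" "Im (\<beta> * ?p) \<le> 0" "Im (\<beta> * ?q) \<le> 0" for \<beta>
  proof -
    have "norm (exp (?q * c \<beta>) - exp (?p * c \<beta>)) \<le>
        exp (- (sqrt 3 / 2 * x * N)) + exp (- (sqrt 3 / 2 * x * N))"
      by (intro order_trans[OF norm_triangle_ineq4] add_mono exp_le Im_ends that)
    then have "norm (I \<beta>) \<le> (2 * exp (- (sqrt 3 / 2 * x * N))) / x"
      unfolding I_def norm_divide by (intro frac_le c_le that x) auto
    then show ?thesis by simp
  qed
  have I: "((\<lambda>l. exp (l * c \<beta>)) has_contour_integral I \<beta>) (contour_D_plus N)" if "Re \<beta> = - 1 / 2" for \<beta>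
  proof -
    have "c \<beta> \<noteq> 0" using c_le[OF that] x by auto
    from has_contour_integral_exp[OF this valid] show ?thesis
      by (simp only: ends I_def)
  qed
  have "((\<lambda>l. alpha\<^sup>2 * exp (l * c alpha) + alpha * exp (l * c (alpha\<^sup>2))) has_contour_integral
      alpha\<^sup>2 * I alpha + alpha * I (alpha\<^sup>2)) (contour_D_plus N)"
  proof (intro has_contour_integral_add has_contour_integral_lmul I)
    show "Re alpha = - 1 / 2" by (simp add: alpha_eq)
    show "Re (alpha\<^sup>2) = - 1 / 2" by (subst alpha_sq_eq) simp
  qed
  moreover have "(\<lambda>l. exp (\<i> * l * of_real x) * sector_kernel l y) =
      (\<lambda>l. alpha\<^sup>2 * exp (l * c alpha) + alpha * exp (l * c (alpha\<^sup>2)))"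
    unfolding sector_kernel_def distrib_left mult.left_commute[of "exp _" "alpha"] mult.left_commute[of "exp _" "alpha\<^sup>2"]
    by (simp only: flip: exp_add) (simp add: c_def algebra_simps)
  ultimately have "contour_integral (contour_D_plus N) (\<lambda>l. exp (\<i> * l * of_real x) * sector_kernel l y)
      = alpha\<^sup>2 * I alpha + alpha * I (alpha\<^sup>2)"
    by (simp add: contour_integral_unique)
  also have "norm \<dots> \<le> norm (I alpha) + norm (I (alpha\<^sup>2))"
    by (rule order_trans[OF norm_triangle_ineq]) (simp add: norm_mult norm_power norm_alpha)
  also have "\<dots> \<le> 2 / x * exp (- (sqrt 3 / 2 * x * N)) + 2 / x * exp (- (sqrt 3 / 2 * x * N))"
  proof (intro add_mono I_le)
    show "Re alpha = - 1 / 2" by (simp add: alpha_eq)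
    show "Re (alpha\<^sup>2) = - 1 / 2" by (subst alpha_sq_eq) simp
  qed (use in_cone in \<open>auto simp only: decay_cone_def mem_Collect_eq\<close>)
  finally show ?thesis
    by simp
qed

lemma sector_part_of_inversion:
  assumes \<phi>: "set_integrable lborel {0..} \<phi>" and x: "x > 0"
  shows "N > 0 \<Longrightarrow> (\<lambda>l. exp (\<i> * l * of_real x) * snd (transform \<phi>) l) contour_integrable_on contour_D_plus N"
    and "((\<lambda>N. contour_integral (contour_D_plus N) (\<lambda>l. exp (\<i> * l * of_real x) * snd (transform \<phi>) l))
           \<longlongrightarrow> 0) at_top"
proof -
  define K where "K = (\<lambda>l y. exp (\<i> * l * of_real x) * sector_kernel l y)"
  have eq: "(\<lambda>l. exp (\<i> * l * of_real x) * snd (transform \<phi>) l) = (\<lambda>l. LINT y:{0..}|lborel. \<phi> y * K l y)"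
    by (simp add: snd_transform K_def mult.left_commute[of _ "exp _"])
  have cont: "continuous_on UNIV (\<lambda>(l, y). K l y)"
    by (auto simp: K_def sector_kernel_def case_prod_beta' intro!: continuous_intros)
  have cont_l: "continuous_on S (\<lambda>l. K l y)" for S y
    unfolding K_def sector_kernel_def by (intro continuous_intros)
  have K_bound: "norm (K l y) \<le> 2" if "l \<in> decay_cone" "y \<in> {0..}" for l y
  proof -
    \<comment> \<open>The cone lies in the upper half-plane because \<open>1 + \<alpha> + \<alpha>\<^sup>2 = 0\<close>.\<close>
    have "Im l = - (Im (alpha * l) + Im (alpha\<^sup>2 * l))"
      unfolding alpha_sq_eq by (simp add: alpha_eq)
    then have "Im l \<ge> 0"
      using that by (simp add: decay_cone_def del: times_complex.sel)
    then have "norm (exp (\<i> * l * of_real x)) \<le> 1"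
      using x by (simp add: norm_exp_eq_Re)
    from mult_mono[OF this norm_sector_kernel_le[of l y]] that show ?thesis
      by (simp add: K_def norm_mult)
  qed
  have Fubini: "((\<lambda>l. LINT y:{0..}|lborel. \<phi> y * K l y) has_contour_integral
      (LINT y:{0..}|lborel. \<phi> y * contour_integral (contour_D_plus N) (\<lambda>l. K l y))) (contour_D_plus N)"
    and int: "set_integrable lborel {0..} (\<lambda>y. \<phi> y * contour_integral (contour_D_plus N) (\<lambda>l. K l y))"
    if N: "N \<ge> 0" for N
  proof -
    let ?p = "of_real N * alpha" and ?q = "- of_real N * alpha\<^sup>2"
    have path: "contour_D_plus N = linepath ?p 0 +++ linepath 0 ?q"
      by (simp add: contour_D_plus_def exp_pi_third_eq flip: alpha_def)
    note rays = sector_rays_in_decay_cone[OF N]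
    note in_ray = has_contour_integral_linepath_Fubini[OF \<phi> cont K_bound[OF subsetD[OF rays(1)]]]
    note out_ray = has_contour_integral_linepath_Fubini[OF \<phi> cont K_bound[OF subsetD[OF rays(2)]]]
    have split: "\<phi> y * contour_integral (contour_D_plus N) (\<lambda>l. K l y) =
        \<phi> y * contour_integral (linepath ?p 0) (\<lambda>l. K l y) + \<phi> y * contour_integral (linepath 0 ?q) (\<lambda>l. K l y)" for y
      unfolding path using cont_l
      by (simp add: contour_integrable_continuous_linepath distrib_left)
    show "set_integrable lborel {0..} (\<lambda>y. \<phi> y * contour_integral (contour_D_plus N) (\<lambda>l. K l y))"
      unfolding split by (intro set_integral_add(1) in_ray(2) out_ray(2))
    have "(LINT y:{0..}|lborel. \<phi> y * contour_integral (contour_D_plus N) (\<lambda>l. K l y)) =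
        (LINT y:{0..}|lborel. \<phi> y * contour_integral (linepath ?p 0) (\<lambda>l. K l y)) +
        (LINT y:{0..}|lborel. \<phi> y * contour_integral (linepath 0 ?q) (\<lambda>l. K l y))"
      unfolding split by (rule set_integral_add(2)[OF in_ray(2) out_ray(2)])
    then show "((\<lambda>l. LINT y:{0..}|lborel. \<phi> y * K l y) has_contour_integral
        (LINT y:{0..}|lborel. \<phi> y * contour_integral (contour_D_plus N) (\<lambda>l. K l y))) (contour_D_plus N)"
      by (simp only: path) (intro has_contour_integral_join in_ray(1) out_ray(1); simp)
  qed
  show "(\<lambda>l. exp (\<i> * l * of_real x) * snd (transform \<phi>) l) contour_integrable_on contour_D_plus N" if "N > 0"
    using Fubini[of N] that unfolding eq contour_integrable_on_def by auto
  define C where "C = (LINT y:{0..}|lborel. norm (\<phi> y))"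
  have le: "norm (contour_integral (contour_D_plus N) (\<lambda>l. exp (\<i> * l * of_real x) * snd (transform \<phi>) l))
      \<le> 4 / x * exp (- (sqrt 3 / 2 * x * N)) * C" if N: "N \<ge> 0" for N
  proof -
    let ?c = "4 / x * exp (- (sqrt 3 / 2 * x * N))"
    have "norm (LINT y:{0..}|lborel. \<phi> y * contour_integral (contour_D_plus N) (\<lambda>l. K l y))
        \<le> (LINT y:{0..}|lborel. norm (\<phi> y * contour_integral (contour_D_plus N) (\<lambda>l. K l y)))"
      by (rule set_integral_norm_bound[OF int[OF N]])
    also have "\<dots> \<le> (LINT y:{0..}|lborel. ?c * norm (\<phi> y))"
      using norm_contour_integral_sector_kernel_le[OF x _ N]
      by (intro set_integral_mono set_integrable_norm[OF int[OF N]] set_integrable_mult_right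
            set_integrable_norm[OF \<phi>])
         (simp only: norm_mult K_def mult.commute[of ?c] mult_left_mono norm_ge_zero atLeast_iff)
    also have "\<dots> = ?c * C"
      unfolding C_def by (rule set_integral_mult_right)
    finally show ?thesis
      unfolding eq contour_integral_unique[OF Fubini[OF N]] .
  qed
  show "((\<lambda>N. contour_integral (contour_D_plus N) (\<lambda>l. exp (\<i> * l * of_real x) * snd (transform \<phi>) l))
           \<longlongrightarrow> 0) at_top"
  proof (rule Lim_null_comparison)
    show "\<forall>\<^sub>F N in at_top. norm (contour_integral (contour_D_plus N)
        (\<lambda>l. exp (\<i> * l * of_real x) * snd (transform \<phi>) l)) \<le> 4 / x * exp (- (sqrt 3 / 2 * x * N)) * C"
      using eventually_ge_at_top[of 0] by eventually_elim (rule le)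
    have "filterlim (\<lambda>N. sqrt 3 / 2 * x * N) at_top at_top"
      using x by (intro filterlim_tendsto_pos_mult_at_top[OF tendsto_const] filterlim_ident) auto
    then have "((\<lambda>N. exp (- (sqrt 3 / 2 * x * N))) \<longlongrightarrow> 0) at_top"
      by (intro filterlim_compose[OF exp_at_bot]) (simp add: filterlim_uminus_at_bot)
    from tendsto_mult_left[OF tendsto_mult_right[OF this, of C], of "4 / x"]
    show "((\<lambda>N. 4 / x * exp (- (sqrt 3 / 2 * x * N)) * C) \<longlongrightarrow> 0) at_top"
      by (simp add: mult.assoc)
  qed
qed

section \<open>Linearity and inversion\<close>

lemma transform_lincomb:
  assumes \<phi>: "set_integrable lborel {0..} \<phi>" and \<psi>: "set_integrable lborel {0..} \<psi>"
  shows "contour_fun_eq (transform (\<lambda>y. a * \<phi> y + b * \<psi> y))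
           (contour_fun_lincomb a (transform \<phi>) b (transform \<psi>))"
proof -
  have lin: "(LINT y:{0..}|lborel. (a * \<phi> y + b * \<psi> y) * k y) =
      a * (LINT y:{0..}|lborel. \<phi> y * k y) + b * (LINT y:{0..}|lborel. \<psi> y * k y)"
    if "continuous_on UNIV k" "\<And>y. y \<in> {0..} \<Longrightarrow> norm (k y) \<le> M" for k :: "real \<Rightarrow> complex" and M
  proof -
    have *: "set_integrable lborel {0..} (\<lambda>y. a * (\<phi> y * k y))" "set_integrable lborel {0..} (\<lambda>y. b * (\<psi> y * k y))"
      using set_integrable_mult_kernel[OF \<phi> that] set_integrable_mult_kernel[OF \<psi> that] by simp_all
    have "(LINT y:{0..}|lborel. (a * \<phi> y + b * \<psi> y) * k y) =
        (LINT y:{0..}|lborel. a * (\<phi> y * k y) + b * (\<psi> y * k y))"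
      by (simp add: algebra_simps)
    then show ?thesis
      using set_integral_add(2)[OF *] by simp
  qed
  have "fst (transform (\<lambda>y. a * \<phi> y + b * \<psi> y)) l = a * fst (transform \<phi>) l + b * fst (transform \<psi>) l"
    if "l \<in> \<real>" for l
  proof -
    have "norm (exp (- \<i> * l * of_real y)) \<le> 1" for y
      using that by (simp add: norm_exp_eq_Re complex_is_Real_iff)
    from lin[OF _ this] show ?thesis
      by (simp add: transform_def mult.commute[of "exp _"] continuous_intros)
  qed
  moreover have "snd (transform (\<lambda>y. a * \<phi> y + b * \<psi> y)) l = a * snd (transform \<phi>) l + b * snd (transform \<psi>) l"
    if "l \<in> frontier D_plus" for l
  proof -
    have "l \<in> decay_cone"
      using that frontier_D_plus_subset by blast
    then have "norm (sector_kernel l y) \<le> 2" if "y \<in> {0..}" for y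
      using that by (simp add: norm_sector_kernel_le)
    moreover have "continuous_on UNIV (sector_kernel l)"
      unfolding sector_kernel_def by (intro continuous_intros)
    ultimately show ?thesis
      unfolding snd_transform by (intro lin)
  qed
  ultimately show ?thesis
    by (simp add: contour_fun_eq_def contour_fun_lincomb_def)
qed

lemma improper_contour_integral_eqI:
  assumes "((\<lambda>N. contour_integral (\<gamma> N) g) \<longlongrightarrow> L) at_top"
  shows "improper_contour_integral \<gamma> g = L"
  unfolding improper_contour_integral_def
  by (rule tendsto_Lim[OF trivial_limit_at_top_linorder assms])

lemma improper_contour_integral_lincomb:
  assumes f: "improper_contour_integrable \<gamma> f" and g: "improper_contour_integrable \<gamma> g"
  shows "improper_contour_integrable \<gamma> (\<lambda>l. a * f l + b * g l)"
    and "improper_contour_integral \<gamma> (\<lambda>l. a * f l + b * g l) =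
           a * improper_contour_integral \<gamma> f + b * improper_contour_integral \<gamma> g"
proof -
  obtain L where L: "((\<lambda>N. contour_integral (\<gamma> N) f) \<longlongrightarrow> L) at_top"
    using f by (auto simp: improper_contour_integrable_def)
  obtain M where M: "((\<lambda>N. contour_integral (\<gamma> N) g) \<longlongrightarrow> M) at_top"
    using g by (auto simp: improper_contour_integrable_def)
  have fg: "((\<lambda>l. a * f l + b * g l) has_contour_integral
      a * contour_integral (\<gamma> N) f + b * contour_integral (\<gamma> N) g) (\<gamma> N)" if "N > 0" for N
    using f g that unfolding improper_contour_integrable_def
    by (intro has_contour_integral_add has_contour_integral_lmul has_contour_integral_integral) auto
  have "\<forall>\<^sub>F N in at_top. a * contour_integral (\<gamma> N) f + b * contour_integral (\<gamma> N) g =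
      contour_integral (\<gamma> N) (\<lambda>l. a * f l + b * g l)"
    using eventually_gt_at_top[of 0] by eventually_elim (simp add: contour_integral_unique[OF fg])
  moreover have "((\<lambda>N. a * contour_integral (\<gamma> N) f + b * contour_integral (\<gamma> N) g) \<longlongrightarrow> a * L + b * M) at_top"
    by (intro tendsto_intros L M)
  ultimately have lim: "((\<lambda>N. contour_integral (\<gamma> N) (\<lambda>l. a * f l + b * g l)) \<longlongrightarrow> a * L + b * M) at_top"
    by (rule Lim_transform_eventually[rotated])
  show "improper_contour_integrable \<gamma> (\<lambda>l. a * f l + b * g l)"
    unfolding improper_contour_integrable_def contour_integrable_on_def using fg lim by blast
  show "improper_contour_integral \<gamma> (\<lambda>l. a * f l + b * g l) =
      a * improper_contour_integral \<gamma> f + b * improper_contour_integral \<gamma> g"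
    using improper_contour_integral_eqI[OF L] improper_contour_integral_eqI[OF M]
      improper_contour_integral_eqI[OF lim] by simp
qed

lemma inverse_transform_lincomb:
  assumes "inverse_transform_exists f x" "inverse_transform_exists g x"
  shows "inverse_transform_exists (contour_fun_lincomb a f b g) x"
    and "inverse_transform (contour_fun_lincomb a f b g) x =
           a * inverse_transform f x + b * inverse_transform g x"
proof -
  have eq: "(\<lambda>l. exp (\<i> * l * of_real x) * (a * u l + b * v l)) =
      (\<lambda>l. a * (exp (\<i> * l * of_real x) * u l) + b * (exp (\<i> * l * of_real x) * v l))" for u v :: "complex \<Rightarrow> complex"
    by (simp add: algebra_simps)
  note fg = assms[unfolded inverse_transform_exists_def]
  note real = improper_contour_integral_lincomb[OF conjunct1[OF fg(1)] conjunct1[OF fg(2)]]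
  note sector = improper_contour_integral_lincomb[OF conjunct2[OF fg(1)] conjunct2[OF fg(2)]]
  show "inverse_transform_exists (contour_fun_lincomb a f b g) x"
    unfolding inverse_transform_exists_def contour_fun_lincomb_def fst_conv snd_conv eq
    by (intro conjI real(1) sector(1))
  show "inverse_transform (contour_fun_lincomb a f b g) x =
      a * inverse_transform f x + b * inverse_transform g x"
    unfolding inverse_transform_def contour_fun_lincomb_def fst_conv snd_conv eq real(2) sector(2)
    by (simp only: distrib_left mult.left_commute add_ac)
qed

lemma inverse_transform_transform:
  assumes \<phi>: "\<phi> \<in> schwartz_halfline" and x: "x > 0"
  shows "inverse_transform_exists (transform \<phi>) x"
    and "inverse_transform (transform \<phi>) x = \<phi> x"
proof -
  have int: "set_integrable lborel {0..} \<phi>"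
    using schwartz_halfline_integrable[OF \<phi>, of 0] by simp
  note real = real_line_part_of_inversion[OF \<phi> x] and sector = sector_part_of_inversion[OF int x]
  show "inverse_transform_exists (transform \<phi>) x"
    unfolding inverse_transform_exists_def improper_contour_integrable_def
    using real sector by blast
  show "inverse_transform (transform \<phi>) x = \<phi> x"
    unfolding inverse_transform_def improper_contour_integral_eqI[OF real(2)]
      improper_contour_integral_eqI[OF sector(2)]
    by simp
qed

theorem proposition3:
  shows "(\<forall>\<phi>\<in>schwartz_halfline. \<forall>\<psi>\<in>schwartz_halfline. \<forall>a b :: complex.
            (\<lambda>y. a * \<phi> y + b * \<psi> y) \<in> schwartz_halfline \<and>
            contour_fun_eq (transform (\<lambda>y. a * \<phi> y + b * \<psi> y))
                           (contour_fun_lincomb a (transform \<phi>) b (transform \<psi>)))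
       \<and> (\<forall>(f :: contour_fun) (g :: contour_fun) (x :: real) (a :: complex) (b :: complex).
            inverse_transform_exists f x \<longrightarrow> inverse_transform_exists g x \<longrightarrow>
            inverse_transform_exists (contour_fun_lincomb a f b g) x \<and>
            inverse_transform (contour_fun_lincomb a f b g) x =
              a * inverse_transform f x + b * inverse_transform g x)
       \<and> (\<forall>\<phi>\<in>schwartz_halfline. \<forall>x>0.
            inverse_transform_exists (transform \<phi>) x \<and>
            inverse_transform (transform \<phi>) x = \<phi> x)"
proof (intro conjI ballI allI impI)
  fix \<phi> \<psi> a b assume \<phi>: "\<phi> \<in> schwartz_halfline" and \<psi>: "\<psi> \<in> schwartz_halfline"
  show "(\<lambda>y. a * \<phi> y + b * \<psi> y) \<in> schwartz_halfline"
    by (rule schwartz_halfline_lincomb[OF \<phi> \<psi>])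
  show "contour_fun_eq (transform (\<lambda>y. a * \<phi> y + b * \<psi> y))
      (contour_fun_lincomb a (transform \<phi>) b (transform \<psi>))"
    using schwartz_halfline_integrable[OF \<phi>, of 0] schwartz_halfline_integrable[OF \<psi>, of 0]
    by (intro transform_lincomb) simp_all
next
  fix f g :: contour_fun and x a b
  assume "inverse_transform_exists f x" "inverse_transform_exists g x"
  note lincomb = inverse_transform_lincomb[OF this, of a b]
  show "inverse_transform_exists (contour_fun_lincomb a f b g) x"
    by (rule lincomb(1))
  show "inverse_transform (contour_fun_lincomb a f b g) x = a * inverse_transform f x + b * inverse_transform g x"
    by (rule lincomb(2))
next
  fix \<phi> and x :: real assume "\<phi> \<in> schwartz_halfline" "0 < x"
  note inversion = inverse_transform_transform[OF this]
  show "inverse_transform_exists (transform \<phi>) x" by (rule inversion(1))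
  show "inverse_transform (transform \<phi>) x = \<phi> x" by (rule inversion(2))
qed

end
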